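(* The lamplighter graph $\mathrm{Lamp}(\mathbb{Z})$ is not $\mathrm{pol}$-polynomially hyperbolic, and consequently the product of free groups $\mathbb{F}_2\times\mathbb{F}_2$ is not $\mathrm{pol}$-polynomially hyperbolic. In other words, there is no polynomial $\eta:[0,+\infty)\to[0,+\infty)$ such that $\mathrm{Lamp}(\mathbb{Z})$ (resp. $\mathbb{F}_2\times\mathbb{F}_2$) is $\eta$-polynomially hyperbolic.
   Context: Connected graphs are identified with their vertex-sets endowed with the path metric, and $B(p,R)$ denotes the closed ball of radius $R$ centred at $p$ (for a graph, a set of vertices). A hyperbolic space is a geodesic metric space that is $\delta$-hyperbolic in the sense of Gromov for some $\delta\ge 0$. Gentle maps: given a locally finite graph $X$, a metric space $Y$, and a function $F:[0,+\infty)^2\to[0,+\infty)$, a map $\varphi:X\to Y$ is $F$-gentle if there exists $C\ge 0$ such that $|B(p,R_1)\cap\varphi^{-1}(B(q,R_2))|\le C\,F(CR_1,CR_2)$ for all $R_1,R_2\ge 1$, $p\in X$, $q\in Y$. Polynomial hyperbolicity: given $\eta:[0,+\infty)\to[0,+\infty)$, a locally finite graph $X$ is $\eta$-polynomially hyperbolic if there exists a Lipschitz map $X\to Y$ to a hyperbolic space $Y$ that is $F$-gentle for $F(x,y)=x^{\eta(y)}$. It is $\mathrm{pol}$-polynomially hyperbolic if it is $\eta$-polynomially hyperbolic for some polynomial $\eta:[0,+\infty)\to[0,+\infty)$. A finitely generated group is said to have such a property if its Cayley graphs with respect to finite generating sets do (the property is invariant under quasi-isometry). $\mathrm{Lamp}(\mathbb{Z})$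 is the graph whose vertices are the pairs $(S,p)$ with $S\subset\mathbb{Z}$ finite and $p\in\mathbb{Z}$, and whose edges connect $(S_1,p_1)$ and $(S_2,p_2)$ whenever either $S_1=S_2$ and $|p_1-p_2|=1$, or $p_1=p_2$ and $S_2=S_1\triangle\{p_1\}$. $\mathbb{F}_2$ is the free group of rank two. *)

theory Defs
  imports
    "HOL-Analysis.Abstract_Metric_Spaces"
    "HOL-Computational_Algebra.Polynomial"
    "HOL-Algebra.Generated_Groups"
begin

section \<open>Connected graphs as metric spaces\<close>

locale connected_locally_finite_graph =
  fixes V :: "'a set" and E :: "('a \<times> 'a) set"
  assumes edges_subset: "E \<subseteq> V \<times> V"
    and edges_sym: "sym E"
    and edges_irrefl: "irrefl E"
    and connected: "\<And>x y. x \<in> V \<Longrightarrow> y \<in> V \<Longrightarrow> (x, y) \<in> E\<^sup>*"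
    and locally_finite: "\<And>x. x \<in> V \<Longrightarrow> finite {y. (x, y) \<in> E}"

definition path_dist :: "('a \<times> 'a) set \<Rightarrow> 'a \<Rightarrow> 'a \<Rightarrow> real" where
  "path_dist E x y = real (LEAST n. (x, y) \<in> E ^^ n)"

definition graph_metric :: "'a set \<Rightarrow> ('a \<times> 'a) set \<Rightarrow> 'a metric" where
  "graph_metric V E = metric (V, path_dist E)"

lemma relpow_sym:
  assumes "sym E" "(x, y) \<in> E ^^ n"
  shows "(y, x) \<in> E ^^ n"
  using assms(2)
proof (induction n arbitrary: y)
  case (Suc n)
  then obtain z where "(x, z) \<in> E ^^ n" "(z, y) \<in> E" by auto
  with Suc.IH assms(1) have "(z, x) \<in> E ^^ n" "(y, z) \<in> E" by (auto dest: symD)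
  then show ?case by (blast intro: relpow_Suc_I2)
qed simp

lemma (in connected_locally_finite_graph) Metric_space_path_dist:
  "Metric_space V (path_dist E)"
proof
  have walk: "(x, y) \<in> E ^^ (LEAST n. (x, y) \<in> E ^^ n)" if "x \<in> V" "y \<in> V" for x y
    using connected[OF that] by (auto simp: rtrancl_power intro: LeastI)
  fix x y z
  show "0 \<le> path_dist E x y" by (simp add: path_dist_def)
  have "(x, y) \<in> E ^^ n \<longleftrightarrow> (y, x) \<in> E ^^ n" for n
    using relpow_sym[OF edges_sym] by blast
  then show "path_dist E x y = path_dist E y x" by (simp add: path_dist_def)
  show "path_dist E x y = 0 \<longleftrightarrow> x = y" if "x \<in> V" "y \<in> V"
  proof
    assume "path_dist E x y = 0"
    then have "(LEAST n. (x, y) \<in> E ^^ n) = 0" by (simp add: path_dist_def)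
    with walk[OF that] show "x = y" by simp
  qed (auto simp: path_dist_def intro: Least_eq_0)
  show "path_dist E x z \<le> path_dist E x y + path_dist E y z"
    if "x \<in> V" "y \<in> V" "z \<in> V"
  proof -
    have "(x, z) \<in> E ^^ ((LEAST n. (x, y) \<in> E ^^ n) + (LEAST n. (y, z) \<in> E ^^ n))"
      using walk[of x y] walk[of y z] that by (auto simp: relpow_add)
    from Least_le[of "\<lambda>n. (x, z) \<in> E ^^ n", OF this] show ?thesis
      unfolding path_dist_def by linarith
  qed
qed


section \<open>Hyperbolic spaces\<close>

definition geodesic_space :: "'b metric \<Rightarrow> bool" where
  "geodesic_space Y \<longleftrightarrow>
     (\<forall>x \<in> mspace Y. \<forall>y \<in> mspace Y. \<exists>\<gamma> \<in> {0..mdist Y x y} \<rightarrow> mspace Y.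
        \<gamma> 0 = x \<and> \<gamma> (mdist Y x y) = y \<and>
        (\<forall>s \<in> {0..mdist Y x y}. \<forall>t \<in> {0..mdist Y x y}. mdist Y (\<gamma> s) (\<gamma> t) = \<bar>s - t\<bar>))"

definition gromov_product :: "'b metric \<Rightarrow> 'b \<Rightarrow> 'b \<Rightarrow> 'b \<Rightarrow> real" where
  "gromov_product Y w x y = (mdist Y w x + mdist Y w y - mdist Y x y) / 2"

definition gromov_hyperbolic :: "real \<Rightarrow> 'b metric \<Rightarrow> bool" where
  "gromov_hyperbolic \<delta> Y \<longleftrightarrow>
     (\<forall>w \<in> mspace Y. \<forall>x \<in> mspace Y. \<forall>y \<in> mspace Y. \<forall>z \<in> mspace Y.
        gromov_product Y w x z \<ge> min (gromov_product Y w x y) (gromov_product Y w y z) - \<delta>)"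

definition hyperbolic_space :: "'b metric \<Rightarrow> bool" where
  "hyperbolic_space Y \<longleftrightarrow> geodesic_space Y \<and> (\<exists>\<delta>\<ge>0. gromov_hyperbolic \<delta> Y)"


section \<open>Gentle maps and polynomial hyperbolicity\<close>

text \<open>
  The source \<open>X\<close> is meant to be the \<open>graph_metric\<close> of a connected, locally finite graph. Its balls
  are then finite, so the finiteness conjunct below holds automatically; it only prevents
  \<open>card\<close> from being 0 on an infinite set.
\<close>

definition gentle :: "(real \<Rightarrow> real \<Rightarrow> real) \<Rightarrow> 'a metric \<Rightarrow> 'b metric \<Rightarrow> ('a \<Rightarrow> 'b) \<Rightarrow> bool" where
  "gentle F X Y \<phi> \<longleftrightarrow>
     \<phi> \<in> mspace X \<rightarrow> mspace Y \<and>
     (\<exists>C\<ge>0. \<forall>R\<^sub>1\<ge>1. \<forall>R\<^sub>2\<ge>1. \<forall>p \<in> mspace X. \<forall>q \<in> mspace Y.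
        finite (mcball_of X p R\<^sub>1 \<inter> \<phi> -` mcball_of Y q R\<^sub>2) \<and>
        real (card (mcball_of X p R\<^sub>1 \<inter> \<phi> -` mcball_of Y q R\<^sub>2)) \<le> C * F (C * R\<^sub>1) (C * R\<^sub>2))"

text \<open>
  HOL cannot quantify existentially over types, so the type of the points of the target space is
  passed as a parameter; a non-hyperbolicity statement that is polymorphic in \<open>'b\<close> then rules out
  all target spaces. The convention for \<open>0 powr 0\<close> is immaterial: in \<open>gentle\<close> the base \<open>C * R\<^sub>1\<close>
  vanishes only if the prefactor \<open>C\<close> does.
\<close>

definition polynomially_hyperbolic :: "'b itself \<Rightarrow> (real \<Rightarrow> real) \<Rightarrow> 'a metric \<Rightarrow> bool" where
  "polynomially_hyperbolic _ \<eta> X \<longleftrightarrow>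
     (\<exists>(Y :: 'b metric) \<phi>. hyperbolic_space Y \<and> Lipschitz_continuous_map X Y \<phi> \<and>
        gentle (\<lambda>x y. x powr \<eta> y) X Y \<phi>)"

definition pol_polynomially_hyperbolic :: "'b itself \<Rightarrow> 'a metric \<Rightarrow> bool" where
  "pol_polynomially_hyperbolic T X \<longleftrightarrow>
     (\<exists>P :: real poly. (\<forall>t\<ge>0. poly P t \<ge> 0) \<and> polynomially_hyperbolic T (poly P) X)"


section \<open>The lamplighter graph\<close>

definition lamp_verts :: "(int set \<times> int) set" where
  "lamp_verts = {S. finite S} \<times> UNIV"

definition lamp_edges :: "((int set \<times> int) \<times> (int set \<times> int)) set" where
  "lamp_edges = {((S\<^sub>1, p\<^sub>1), (S\<^sub>2, p\<^sub>2)). finite S\<^sub>1 \<and> finite S\<^sub>2 \<and>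
     (S\<^sub>1 = S\<^sub>2 \<and> \<bar>p\<^sub>1 - p\<^sub>2\<bar> = 1 \<or> p\<^sub>1 = p\<^sub>2 \<and> S\<^sub>2 = sym_diff S\<^sub>1 {p\<^sub>1})}"

definition Lamp_Z :: "(int set \<times> int) metric" where
  "Lamp_Z = graph_metric lamp_verts lamp_edges"

lemma lamp_graph: "connected_locally_finite_graph lamp_verts lamp_edges"
proof
  show "lamp_edges \<subseteq> lamp_verts \<times> lamp_verts" by (auto simp: lamp_edges_def lamp_verts_def)
  show sym: "sym lamp_edges" by (rule symI) (auto simp: lamp_edges_def)
  show "irrefl lamp_edges" by (rule irreflI) (auto simp: lamp_edges_def)
  have up: "((S, p), (S, p + int n)) \<in> lamp_edges\<^sup>*" if "finite S" for S p n
  proof (induction n)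
    case (Suc n)
    have "((S, p + int n), (S, p + int (Suc n))) \<in> lamp_edges"
      using that by (auto simp: lamp_edges_def)
    with Suc show ?case by (rule rtrancl_into_rtrancl)
  qed simp
  have inv: "(y, x) \<in> lamp_edges\<^sup>*" if "(x, y) \<in> lamp_edges\<^sup>*" for x y
    using that sym_rtrancl[OF sym] by (meson symD)
  have move: "((S, p), (S, q)) \<in> lamp_edges\<^sup>*" if "finite S" for S p q
  proof (cases "p \<le> q")
    case True with up[OF that, of p "nat (q - p)"] show ?thesis by simp
  next
    case False with inv[OF up[OF that, of q "nat (p - q)"]] show ?thesis by simp
  qed
  have base: "((S, p), ({}, 0)) \<in> lamp_edges\<^sup>*" if "finite S" for S p
    using that
  proof (induction S arbitrary: p rule: finite_induct)
    case empty
    show ?case by (rule move) simp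
  next
    case (insert a S)
    have "((insert a S, p), (insert a S, a)) \<in> lamp_edges\<^sup>*" using insert by (intro move) simp
    also have "((insert a S, a), (S, a)) \<in> lamp_edges" using insert by (auto simp: lamp_edges_def)
    also have "((S, a), ({}, 0)) \<in> lamp_edges\<^sup>*" by (rule insert.IH)
    finally show ?case .
  qed
  show "(x, y) \<in> lamp_edges\<^sup>*" if "x \<in> lamp_verts" "y \<in> lamp_verts" for x y
  proof -
    have "(x, ({}, 0)) \<in> lamp_edges\<^sup>*" "(y, ({}, 0)) \<in> lamp_edges\<^sup>*"
      using that base by (auto simp: lamp_verts_def)
    then show ?thesis by (meson inv rtrancl_trans)
  qed
  show "finite {y. (x, y) \<in> lamp_edges}" for x
  proof (cases x)
    case (Pair S p)
    have "{y. (x, y) \<in> lamp_edges} \<subseteq> {(S, p + 1), (S, p - 1), (sym_diff S {p}, p)}"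
      unfolding Pair lamp_edges_def by (auto simp: abs_if split: if_splits)
    then show ?thesis by (rule finite_subset) simp
  qed
qed


section \<open>Cayley graphs\<close>

definition finite_generating_set :: "('a, 'm) monoid_scheme \<Rightarrow> 'a set \<Rightarrow> bool" where
  "finite_generating_set G S \<longleftrightarrow> finite S \<and> S \<subseteq> carrier G \<and> generate G S = carrier G"

definition cayley_edges :: "('a, 'm) monoid_scheme \<Rightarrow> 'a set \<Rightarrow> ('a \<times> 'a) set" where
  "cayley_edges G S = {(g, h). g \<in> carrier G \<and> h \<in> carrier G \<and> g \<noteq> h \<and>
     (\<exists>s \<in> S. h = g \<otimes>\<^bsub>G\<^esub> s \<or> g = h \<otimes>\<^bsub>G\<^esub> s)}"

definition Cayley :: "('a, 'm) monoid_scheme \<Rightarrow> 'a set \<Rightarrow> 'a metric" where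
  "Cayley G S = graph_metric (carrier G) (cayley_edges G S)"

lemma (in group) cayley_graph:
  assumes "finite_generating_set G S"
  shows "connected_locally_finite_graph (carrier G) (cayley_edges G S)"
proof
  from assms have S: "finite S" "S \<subseteq> carrier G" "generate G S = carrier G"
    by (auto simp: finite_generating_set_def)
  show "cayley_edges G S \<subseteq> carrier G \<times> carrier G" by (auto simp: cayley_edges_def)
  show sym: "sym (cayley_edges G S)" by (rule symI) (auto simp: cayley_edges_def)
  show "irrefl (cayley_edges G S)" by (rule irreflI) (auto simp: cayley_edges_def)
  have reach: "(g, g \<otimes> x) \<in> (cayley_edges G S)\<^sup>*" if "x \<in> generate G S" "g \<in> carrier G" for g x
    using that
  proof (induction arbitrary: g rule: generate.induct)
    case one
    then show ?case by simp
  next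
    case (incl h)
    then have "g = g \<otimes> h \<or> (g, g \<otimes> h) \<in> cayley_edges G S"
      using S by (auto simp: cayley_edges_def)
    then show ?case by (metis r_into_rtrancl rtrancl.rtrancl_refl)
  next
    case (inv h)
    then have h: "h \<in> carrier G" using S by auto
    then have "g = (g \<otimes> inv h) \<otimes> h" using inv by (simp add: m_assoc)
    then have "g = g \<otimes> inv h \<or> (g, g \<otimes> inv h) \<in> cayley_edges G S"
      using inv h by (auto simp: cayley_edges_def)
    then show ?case by (metis r_into_rtrancl rtrancl.rtrancl_refl)
  next
    case (eng a b)
    then have ab: "a \<in> carrier G" "b \<in> carrier G" using S by auto
    have "(g, g \<otimes> a) \<in> (cayley_edges G S)\<^sup>*" using eng by blast
    moreover have "(g \<otimes> a, g \<otimes> a \<otimes> b) \<in> (cayley_edges G S)\<^sup>*" using eng ab by blast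
    ultimately show ?case using eng.prems ab by (metis m_assoc rtrancl_trans)
  qed
  show "(x, y) \<in> (cayley_edges G S)\<^sup>*" if "x \<in> carrier G" "y \<in> carrier G" for x y
  proof -
    have "y = x \<otimes> (inv x \<otimes> y)" using that by (simp add: m_assoc[symmetric])
    with reach[of "inv x \<otimes> y" x] that S(3) show ?thesis by simp
  qed
  show "finite {y. (x, y) \<in> cayley_edges G S}" for x
  proof -
    have "{y. (x, y) \<in> cayley_edges G S} \<subseteq> (\<lambda>s. x \<otimes> s) ` S \<union> (\<lambda>s. x \<otimes> inv s) ` S"
    proof
      fix y assume "y \<in> {y. (x, y) \<in> cayley_edges G S}"
      then obtain s where s: "y \<in> carrier G" "s \<in> S" "y = x \<otimes> s \<or> x = y \<otimes> s"
        by (auto simp: cayley_edges_def)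
      then have "s \<in> carrier G" using S by auto
      with s have "y = x \<otimes> s \<or> y = x \<otimes> inv s" by (auto simp: m_assoc)
      with s show "y \<in> (\<lambda>s. x \<otimes> s) ` S \<union> (\<lambda>s. x \<otimes> inv s) ` S" by auto
    qed
    then show ?thesis using S(1) by (auto intro: finite_subset)
  qed
qed


section \<open>Free groups\<close>

text \<open>
  The free group on \<open>A\<close>, realised on the reduced words in the letters \<open>A \<times> {True, False}\<close>, where
  \<open>(a, True)\<close> stands for the generator \<open>a\<close> and \<open>(a, False)\<close> for its inverse.
\<close>

definition inv_letter :: "'a \<times> bool \<Rightarrow> 'a \<times> bool" where
  "inv_letter x = (fst x, \<not> snd x)"

definition reduced :: "('a \<times> bool) list \<Rightarrow> bool" where
  "reduced w \<longleftrightarrow> successively (\<lambda>x y. y \<noteq> inv_letter x) w"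

fun cons_reduce :: "'a \<times> bool \<Rightarrow> ('a \<times> bool) list \<Rightarrow> ('a \<times> bool) list" where
  "cons_reduce x [] = [x]"
| "cons_reduce x (y # w) = (if y = inv_letter x then w else x # y # w)"

definition free_group :: "'a set \<Rightarrow> ('a \<times> bool) list monoid" where
  "free_group A = \<lparr>carrier = {w. fst ` set w \<subseteq> A \<and> reduced w},
     mult = (\<lambda>u v. foldr cons_reduce u v), one = []\<rparr>"

lemma inv_letter_simps [simp]:
  "inv_letter (inv_letter x) = x" "inv_letter x \<noteq> x" "x \<noteq> inv_letter x"
  "fst (inv_letter x) = fst x"
  by (auto simp: inv_letter_def prod_eq_iff)

lemma reduced_ConsD: "reduced (x # w) \<Longrightarrow> reduced w"
  by (cases w) (auto simp: reduced_def)

lemma reduced_cons_reduce: "reduced w \<Longrightarrow> reduced (cons_reduce x w)"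
  by (cases w) (auto simp: reduced_def dest: reduced_ConsD[unfolded reduced_def])

lemma cons_reduce_reduced: "reduced (x # w) \<Longrightarrow> cons_reduce x w = x # w"
  by (cases w) (auto simp: reduced_def)

lemma cons_reduce_inv: "reduced w \<Longrightarrow> cons_reduce x (cons_reduce (inv_letter x) w) = w"
  by (cases w) (auto simp: cons_reduce_reduced)

lemma reduced_foldr: "reduced v \<Longrightarrow> reduced (foldr cons_reduce u v)"
  by (induction u) (auto intro: reduced_cons_reduce)

lemma set_cons_reduce: "set (cons_reduce x w) \<subseteq> insert x (set w)"
  by (cases w) auto

lemma set_foldr_cons_reduce: "set (foldr cons_reduce u v) \<subseteq> set u \<union> set v"
  using set_cons_reduce by (induction u) fastforce+

lemma foldr_cons_reduce_Nil: "reduced u \<Longrightarrow> foldr cons_reduce u [] = u"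
proof (induction u)
  case (Cons x u)
  from Cons.prems have "reduced u" by (rule reduced_ConsD)
  with Cons show ?case by (simp add: cons_reduce_reduced)
qed simp

lemma foldr_cons_reduce_cons:
  "reduced w \<Longrightarrow> foldr cons_reduce (cons_reduce x v) w = cons_reduce x (foldr cons_reduce v w)"
  by (cases v) (auto simp: cons_reduce_inv reduced_foldr)

lemma foldr_cons_reduce_assoc:
  "reduced w \<Longrightarrow>
   foldr cons_reduce (foldr cons_reduce u v) w = foldr cons_reduce u (foldr cons_reduce v w)"
  by (induction u) (auto simp: foldr_cons_reduce_cons)

lemma foldr_rev_inv:
  "reduced v \<Longrightarrow> foldr cons_reduce (rev (map inv_letter u)) (foldr cons_reduce u v) = v"
proof (induction u arbitrary: v)
  case (Cons x u)
  have "cons_reduce (inv_letter x) (cons_reduce x (foldr cons_reduce u v)) = foldr cons_reduce u v"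
    using cons_reduce_inv[of "foldr cons_reduce u v" "inv_letter x"] Cons.prems
    by (simp add: reduced_foldr)
  with Cons show ?case by simp
qed simp

lemma reduced_rev_inv: "reduced u \<Longrightarrow> reduced (rev (map inv_letter u))"
  unfolding reduced_def successively_rev successively_map
  by (erule successively_mono) (metis inv_letter_simps(1))

lemma group_free_group: "group (free_group A)"
proof (rule groupI)
  fix u v w
  assume u: "u \<in> carrier (free_group A)" and v: "v \<in> carrier (free_group A)"
  show "u \<otimes>\<^bsub>free_group A\<^esub> v \<in> carrier (free_group A)"
    using u v set_foldr_cons_reduce[of u v] by (fastforce simp: free_group_def reduced_foldr)
  assume w: "w \<in> carrier (free_group A)"
  show "u \<otimes>\<^bsub>free_group A\<^esub> v \<otimes>\<^bsub>free_group A\<^esub> w = u \<otimes>\<^bsub>free_group A\<^esub> (v \<otimes>\<^bsub>free_group A\<^esub> w)"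
    using w by (simp add: free_group_def foldr_cons_reduce_assoc)
next
  fix u assume u: "u \<in> carrier (free_group A)"
  show "\<exists>v \<in> carrier (free_group A). v \<otimes>\<^bsub>free_group A\<^esub> u = \<one>\<^bsub>free_group A\<^esub>"
  proof
    show "rev (map inv_letter u) \<in> carrier (free_group A)"
      using u by (auto simp: free_group_def reduced_rev_inv)
    have "foldr cons_reduce (rev (map inv_letter u)) (foldr cons_reduce u []) = []"
      by (rule foldr_rev_inv) (simp add: reduced_def)
    then show "rev (map inv_letter u) \<otimes>\<^bsub>free_group A\<^esub> u = \<one>\<^bsub>free_group A\<^esub>"
      using u by (simp add: free_group_def foldr_cons_reduce_Nil)
  qed
qed (auto simp: free_group_def reduced_def)

abbreviation F2 :: "(bool \<times> bool) list monoid" where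
  "F2 \<equiv> free_group (UNIV :: bool set)"

end

theory Submission
  imports Defs "HOL-Analysis.Convex" "HOL-Real_Asymp.Real_Asymp"
begin

text \<open>
  Let \<open>\<phi>\<close> be a Lipschitz map from the lamplighter graph to a hyperbolic space \<open>Y\<close>, and consider the
  \<open>2\<^sup>N\<close> configurations over \<open>{0..<N}\<close>. Their images have mutual Gromov products of size \<open>O(N)\<close>, so a
  pigeonhole argument yields a point \<open>m\<close> of \<open>Y\<close> that, for a proportion \<open>1 / poly(N)\<close> of all pairs of
  configurations, is at bounded distance from the geodesic between their images. In a hyperbolic
  space a path of length \<open>n\<close> passes within \<open>O(log n)\<close> of every point of the geodesic between its ends.
  Hence the image of the walk of length \<open>O(N)\<close> from one configuration to the other meets the ball of
  radius \<open>O(log N)\<close> around \<open>m\<close>. A vertex lies on at most \<open>O(N) * 2\<^sup>N\<close> of the \<open>4\<^sup>N\<close> walks, so the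
  preimage of that ball contains at least \<open>2\<^sup>N / poly(N)\<close> vertices at distance \<open>O(N)\<close> from a base
  point, whereas gentleness with polynomial \<open>\<eta>\<close> allows only \<open>exp(polylog(N))\<close>.

  For the product of two free groups it suffices that it contains an injective image of the lamplighter
  graph over each segment, with adjacent vertices at distances bounded independently of \<open>N\<close>.
\<close>

section \<open>Gromov hyperbolicity\<close>

lemma gromov_product_commute: "gromov_product Y w x y = gromov_product Y w y x"
  by (simp add: gromov_product_def mdist_commute add.commute)

lemma gromov_product_nonneg:
  assumes "w \<in> mspace Y" "x \<in> mspace Y" "y \<in> mspace Y"
  shows "0 \<le> gromov_product Y w x y"
  using mdist_triangle[of x Y w y] assms by (simp add: gromov_product_def mdist_commute)

lemma gromov_product_le_mdist:
  assumes "w \<in> mspace Y" "x \<in> mspace Y" "y \<in> mspace Y"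
  shows "gromov_product Y w x y \<le> mdist Y w x"
  using mdist_triangle[of w Y x y] assms by (simp add: gromov_product_def)

lemma gromov_product_ge:
  assumes "w \<in> mspace Y" "x \<in> mspace Y" "y \<in> mspace Y"
  shows "mdist Y w x - mdist Y x y \<le> gromov_product Y w x y"
  using mdist_triangle[of w Y y x] assms by (simp add: gromov_product_def mdist_commute[of Y x y])

lemma gromov_hyperbolicD:
  assumes "gromov_hyperbolic \<delta> Y" "w \<in> mspace Y" "x \<in> mspace Y" "y \<in> mspace Y" "z \<in> mspace Y"
  shows "min (gromov_product Y w x y) (gromov_product Y w y z) - \<delta> \<le> gromov_product Y w x z"
  using assms by (simp add: gromov_hyperbolic_def)

text \<open>Induction by halving: the two halves are joined at their common endpoint at the cost of
  one \<delta>, so a chain of \<open>2 ^ k\<close> steps loses only \<open>k * \<delta>\<close>.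
  This is the source of the logarithm. The offset \<open>s\<close> lets the hypothesis apply to both
  halves.\<close>

lemma gromov_product_chain:
  assumes hyp: "gromov_hyperbolic \<delta> Y" and m: "m \<in> mspace Y" and c: "\<And>i. c i \<in> mspace Y"
    and D: "\<And>i. i < s + 2 ^ k \<Longrightarrow> D \<le> gromov_product Y m (c i) (c (Suc i))"
  shows "D - real k * \<delta> \<le> gromov_product Y m (c s) (c (s + 2 ^ k))"
  using D
proof (induction k arbitrary: s)
  case 0
  then show ?case by simp
next
  case (Suc k)
  have "D - real k * \<delta> \<le> gromov_product Y m (c s) (c (s + 2 ^ k))"
    by (rule Suc.IH) (use Suc.prems in auto)
  moreover have "D - real k * \<delta> \<le> gromov_product Y m (c (s + 2 ^ k)) (c (s + 2 ^ k + 2 ^ k))"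
    by (rule Suc.IH) (use Suc.prems in auto)
  moreover have *: "s + 2 ^ Suc k = s + 2 ^ k + 2 ^ k" by simp
  ultimately show ?case
    using gromov_hyperbolicD[OF hyp m c[of s] c[of "s + 2 ^ k"] c[of "s + 2 ^ k + 2 ^ k"]]
    unfolding * by (simp add: distrib_right)
qed

text \<open>Two points far from \<open>m\<close> but within \<open>l\<close> of each other have a
  large Gromov product at \<open>m\<close>. If the whole chain stayed outside the ball,
  \<open>gromov_product_chain\<close> would force the product of its ends to be at least
  \<open>r\<close>.\<close>

lemma chain_meets_ball:
  assumes hyp: "gromov_hyperbolic \<delta> Y" and m: "m \<in> mspace Y" and c: "\<And>i. c i \<in> mspace Y"
    and step: "\<And>i. i < 2 ^ k \<Longrightarrow> mdist Y (c i) (c (Suc i)) \<le> l"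
    and r: "gromov_product Y m (c 0) (c (2 ^ k)) < r"
  shows "\<exists>i < 2 ^ k. mdist Y m (c i) \<le> r + l + real k * \<delta>"
proof (rule ccontr)
  assume contra: "\<not> ?thesis"
  have "r + real k * \<delta> \<le> gromov_product Y m (c i) (c (Suc i))" if "i < 0 + 2 ^ k" for i
    using gromov_product_ge[OF m c[of i] c[of "Suc i"]] step[of i] contra that
    by (simp add: not_le) (smt (verit))
  from gromov_product_chain[where s = 0 and c = c and k = k, OF hyp m c this] r show False by simp
qed

text \<open>
  The point at distance \<open>j\<close> from \<open>w\<close> on a geodesic towards \<open>x\<close> is where, in a tree, the geodesics
  to \<open>y\<close> and \<open>z\<close> would separate.
\<close>

lemma ex_branch_point:
  assumes geo: "geodesic_space Y" and hyp: "gromov_hyperbolic \<delta> Y"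
    and w: "w \<in> mspace Y" and x: "x \<in> mspace Y" and j: "0 \<le> j" "j \<le> mdist Y w x"
  shows "\<exists>m \<in> mspace Y. \<forall>y \<in> mspace Y. \<forall>z \<in> mspace Y.
    j \<le> gromov_product Y w y x \<longrightarrow> j \<le> gromov_product Y w y z \<longrightarrow>
    gromov_product Y w y z < j + 1 \<longrightarrow> gromov_product Y m y z < 3 * \<delta> + 1"
proof -
  obtain \<gamma> where \<gamma>: "\<gamma> \<in> {0..mdist Y w x} \<rightarrow> mspace Y" "\<gamma> 0 = w" "\<gamma> (mdist Y w x) = x"
    "\<And>s t. s \<in> {0..mdist Y w x} \<Longrightarrow> t \<in> {0..mdist Y w x} \<Longrightarrow> mdist Y (\<gamma> s) (\<gamma> t) = \<bar>s - t\<bar>"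
    using geo w x unfolding geodesic_space_def by blast
  define m where "m = \<gamma> j"
  have m: "m \<in> mspace Y" using \<gamma>(1) j by (auto simp: m_def)
  have wm: "mdist Y w m = j" and mx: "mdist Y m x = mdist Y w x - j"
    using \<gamma>(4)[of 0 j] \<gamma>(4)[of j "mdist Y w x"] \<gamma>(2,3) j by (auto simp: m_def)
  have "gromov_product Y m y z < 3 * \<delta> + 1"
    if y: "y \<in> mspace Y" and z: "z \<in> mspace Y"
      and jyx: "j \<le> gromov_product Y w y x" and jyz: "j \<le> gromov_product Y w y z"
      and yz: "gromov_product Y w y z < j + 1" for y z
  proof -
    have d: "0 \<le> \<delta>"
      using gromov_hyperbolicD[OF hyp w w w w] by simp
    have "gromov_product Y w x m = j" using wm mx
      by (simp add: gromov_product_def mdist_commute[of Y x m])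
    then have 1: "j - \<delta> \<le> gromov_product Y w m y"
      using gromov_hyperbolicD[OF hyp w y x m] jyx by (simp add: gromov_product_commute)
    then have 2: "j - 2 * \<delta> \<le> gromov_product Y w m z"
      using gromov_hyperbolicD[OF hyp w m y z] jyz d by simp
    \<comment> \<open>Writing \<open>(y|z)_w\<close> for the Gromov product at \<open>w\<close>, one
      has \<open>(y|z)_m = j + (y|z)_w - (m|y)_w - (m|z)_w\<close>. The two subtracted terms are at
      least \<open>j - \<delta>\<close> and \<open>j - 2 * \<delta>\<close>.\<close>
    from 1 2 yz wm show ?thesis by (simp add: gromov_product_def field_simps)
  qed
  with m show ?thesis by blast
qed

section \<open>Two counting lemmas\<close>

text \<open>
  Counting triples \<open>x\<close>, \<open>y\<close>, \<open>z\<close> with \<open>f y x = f y z\<close> by means of the Cauchy--Schwarz inequality.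
\<close>

lemma ex_popular_value:
  fixes f :: "'v \<Rightarrow> 'v \<Rightarrow> nat"
  assumes V: "finite V" "V \<noteq> {}" and f: "\<And>y z. y \<in> V \<Longrightarrow> z \<in> V \<Longrightarrow> f y z < n"
  shows "\<exists>x \<in> V. \<exists>j < n. (card V)\<^sup>2 \<le> n\<^sup>2 * card {(y, z). y \<in> V \<and> z \<in> V \<and> f y x = j \<and> f y z = j}"
proof (rule ccontr)
  define a where "a y j = card {z \<in> V. f y z = j}" for y j
  define t where "t x j = card {(y, z). y \<in> V \<and> z \<in> V \<and> f y x = j \<and> f y z = j}" for x j
  assume "\<not> ?thesis"
  then have less: "n\<^sup>2 * t x j < (card V)\<^sup>2" if "x \<in> V" "j < n" for x j
    using that unfolding t_def by (meson not_le)
  have M: "card V > 0" using V by (simp add: card_gt_0_iff)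
  obtain v where "v \<in> V" using V by blast
  then have n: "n > 0" using f[of v v] by simp
  have suma: "(\<Sum>j<n. a y j) = card V" if "y \<in> V" for y
  proof -
    have "f y ` V \<subseteq> {..<n}" using f that by auto
    from sum.group[OF V(1) _ this, of "\<lambda>_. 1::nat"] show ?thesis by (simp add: a_def)
  qed
  have tx: "t x j = (\<Sum>y | y \<in> V \<and> f y x = j. a y j)" for x j
  proof -
    have "{(y, z). y \<in> V \<and> z \<in> V \<and> f y x = j \<and> f y z = j}
        = (SIGMA y:{y \<in> V. f y x = j}. {z \<in> V. f y z = j})" by auto
    then show ?thesis using V(1) by (simp add: t_def a_def)
  qed
  \<comment> \<open>Count the triples with \<open>y\<close> first: \<open>x\<close> and
    \<open>z\<close> then range independently over the same set of size
    \<open>a y j\<close>.\<close>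
  have "(\<Sum>x\<in>V. t x j) = (\<Sum>y\<in>V. (a y j)\<^sup>2)" for j
    unfolding tx
    by (subst sum.swap_restrict[OF V(1) V(1)]) (simp add: a_def power2_eq_square)
  then have total: "(\<Sum>j<n. \<Sum>x\<in>V. t x j) = (\<Sum>y\<in>V. \<Sum>j<n. (a y j)\<^sup>2)"
    by (simp add: sum.swap[of _ V])
  have cs: "(card V)\<^sup>2 \<le> n * (\<Sum>j<n. (a y j)\<^sup>2)" if "y \<in> V" for y
  proof -
    have "(\<Sum>j<n. real (a y j))\<^sup>2 \<le> (\<Sum>j<n. (real (a y j))\<^sup>2) * real (card {..<n})"
      by (rule sum_squared_le_sum_of_squares)
    then have "real ((\<Sum>j<n. a y j)\<^sup>2) \<le> real (n * (\<Sum>j<n. (a y j)\<^sup>2))"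
      by (simp add: mult.commute)
    then show ?thesis using suma[OF that] by (simp only: of_nat_le_iff)
  qed
  \<comment> \<open>Averaging over the \<open>n * card V\<close> pairs \<open>(x, j)\<close>: by
    \<open>cs\<close> there are at least \<open>card V ^ 3 / n\<close> triples in all, so some pair
    has at least the average \<open>card V ^ 2 / n ^ 2\<close>.\<close>
  have "n * (card V * (card V)\<^sup>2) \<le> n * (\<Sum>y\<in>V. n * (\<Sum>j<n. (a y j)\<^sup>2))"
    using sum_bounded_below[of V "(card V)\<^sup>2" "\<lambda>y. n * (\<Sum>j<n. (a y j)\<^sup>2)"] cs by simp
  also have "\<dots> = (\<Sum>j<n. \<Sum>x\<in>V. n\<^sup>2 * t x j)"
    by (simp add: sum_distrib_left[symmetric] total power2_eq_square mult.assoc)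
  also have "\<dots> < (\<Sum>j<n. \<Sum>x\<in>V. (card V)\<^sup>2)"
    using n V less by (intro sum_strict_mono) auto
  also have "\<dots> = n * (card V * (card V)\<^sup>2)" by simp
  finally show False by simp
qed

text \<open>The lamps at time \<open>i\<close> when a lamplighter walking to the right from 0 turns
  \<open>S\<close> into \<open>T\<close>.\<close>

definition sweep :: "nat \<Rightarrow> nat set \<Rightarrow> nat set \<Rightarrow> nat set" where
  "sweep i S T = (T \<inter> {..<i}) \<union> (S - {..<i})"

text \<open>
  A pair \<open>(S, T)\<close> is determined by the position \<open>i\<close>, the point reached at time \<open>i\<close> on the way from
  \<open>S\<close> to \<open>T\<close>, and the point reached at time \<open>i\<close> on the way from \<open>T\<close> to \<open>S\<close>.
\<close>

lemma card_sweeps_through: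
  assumes K: "finite K" and inj: "inj_on \<psi> (Pow {..<N} \<times> {..N})"
    and b: "\<And>i. i < n \<Longrightarrow> b i \<le> N"
    and H: "H \<subseteq> Pow {..<N} \<times> Pow {..<N}"
      "\<And>S T. (S, T) \<in> H \<Longrightarrow> \<exists>i < n. \<psi> (sweep i S T, b i) \<in> K"
  shows "card H \<le> n * card K * 2 ^ N"
proof -
  define dec where "dec v = fst (inv_into (Pow {..<N} \<times> {..N}) \<psi> v)" for v
  \<comment> \<open>Exchanging the parts below \<open>i\<close> is an involution on pairs, so
    sweeping once more recovers \<open>(S, T)\<close>. Values of \<open>dec\<close> off the image of
    \<psi> are arbitrary, which is harmless because \<open>g\<close> only has to cover
    \<open>H\<close>.\<close>
  define g where "g = (\<lambda>(i, v, W). (sweep i (dec v) W, sweep i W (dec v)))"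
  have sub: "sweep i S T \<in> Pow {..<N}" if "(S, T) \<in> H \<or> (T, S) \<in> H" for i S T
    using that H(1) by (auto simp: sweep_def)
  have "H \<subseteq> g ` ({..<n} \<times> K \<times> Pow {..<N})"
  proof
    fix x assume "x \<in> H"
    then obtain S T where x: "x = (S, T)" and ST: "(S, T) \<in> H" by (cases x) auto
    obtain i where i: "i < n" "\<psi> (sweep i S T, b i) \<in> K" using H(2)[OF ST] by blast
    have "dec (\<psi> (sweep i S T, b i)) = sweep i S T"
      unfolding dec_def using inv_into_f_f[OF inj, of "(sweep i S T, b i)"] sub ST b i by auto
    then have "x = g (i, \<psi> (sweep i S T, b i), sweep i T S)"
      unfolding x g_def by (auto simp: sweep_def)
    with i sub[of T S i] ST show "x \<in> g ` ({..<n} \<times> K \<times> Pow {..<N})" by auto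
  qed
  then have "card H \<le> card ({..<n} \<times> K \<times> Pow {..<N})"
    using K by (intro surj_card_le) auto
  also have "\<dots> = n * card K * 2 ^ N" using K by (simp add: card_Pow)
  finally show ?thesis .
qed

section \<open>Finite lamplighter graphs in a metric space\<close>

text \<open>
  A copy in \<open>X\<close> of the lamplighter graph over the segment \<open>{..N}\<close>. Passing from \<open>p\<close> to \<open>Suc p\<close> may
  change the lamp at \<open>p\<close>.
\<close>

definition lamp_grid :: "'a metric \<Rightarrow> real \<Rightarrow> nat \<Rightarrow> (nat set \<times> nat \<Rightarrow> 'a) \<Rightarrow> bool" where
  "lamp_grid X A N \<psi> \<longleftrightarrow> \<psi> \<in> Pow {..<N} \<times> {..N} \<rightarrow> mspace X \<and> inj_on \<psi> (Pow {..<N} \<times> {..N}) \<and>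
     (\<forall>S \<in> Pow {..<N}. \<forall>T \<in> Pow {..<N}. \<forall>p<N. S - {p} = T - {p} \<longrightarrow>
        mdist X (\<psi> (S, p)) (\<psi> (T, Suc p)) \<le> A)"

lemma mdist_chain_le:
  assumes c: "\<And>i. c i \<in> mspace X" and step: "\<And>i. i < n \<Longrightarrow> mdist X (c i) (c (Suc i)) \<le> A"
  shows "mdist X (c 0) (c n) \<le> real n * A"
  using step
proof (induction n)
  case 0
  show ?case using mdist_zero[OF c[of 0] c[of 0]] by simp
next
  case (Suc n)
  then have "mdist X (c 0) (c n) \<le> real n * A" "mdist X (c n) (c (Suc n)) \<le> A" by auto
  with mdist_triangle[OF c[of 0] c[of n] c[of "Suc n"]] show ?case by (simp add: algebra_simps)
qed

text \<open>The lamplighter walks from \<open>0\<close> to \<open>N\<close>, turning \<open>S\<close> into \<open>T\<close>, and then back to \<open>0\<close>.\<close>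

lemma lamp_grid_walk:
  assumes grid: "lamp_grid X A N \<psi>" and S: "S \<subseteq> {..<N}" and T: "T \<subseteq> {..<N}"
  defines "c \<equiv> \<lambda>i. \<psi> (sweep i S T, if i \<le> N then i else 2 * N - i)"
  shows "c i \<in> mspace X" and "i < 2 * N \<Longrightarrow> mdist X (c i) (c (Suc i)) \<le> A"
    and "c 0 = \<psi> (S, 0)" and "c (2 * N) = \<psi> (T, 0)"
proof -
  have sub: "sweep i S T \<in> Pow {..<N}" for i using S T by (auto simp: sweep_def)
  show ci: "c i \<in> mspace X" for i
    using grid sub[of i] unfolding lamp_grid_def c_def by (auto simp: Pi_iff)
  have late: "sweep i S T = T" if "N \<le> i" for i using that S T by (force simp: sweep_def)
  have adj: "mdist X (\<psi> (S, p)) (\<psi> (T, Suc p)) \<le> A"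
    if "S \<in> Pow {..<N}" "T \<in> Pow {..<N}" "p < N" "S - {p} = T - {p}" for S T p
    using grid that by (simp add: lamp_grid_def)
  show "mdist X (c i) (c (Suc i)) \<le> A" if "i < 2 * N"
  proof (cases "i < N")
    case True
    have "sweep i S T - {i} = sweep (Suc i) S T - {i}" by (auto simp: sweep_def less_Suc_eq)
    from adj[OF sub sub True this] True show ?thesis by (simp add: c_def)
  next
    case False
    \<comment> \<open>On the way back the lamps already equal \<open>T\<close>, and each step is a
      grid edge traversed in reverse.\<close>
    have eq: "c i = \<psi> (T, Suc (2 * N - Suc i))" "c (Suc i) = \<psi> (T, 2 * N - Suc i)"
      using False that late[of i] late[of "Suc i"] by (auto simp: c_def Suc_diff_Suc)
    show ?thesis
      unfolding eq using adj[of T T "2 * N - Suc i"] T False that by (simp add: mdist_commute)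
  qed
  show "c 0 = \<psi> (S, 0)" by (simp add: c_def sweep_def)
  show "c (2 * N) = \<psi> (T, 0)" using late[of "2 * N"] by (cases N) (auto simp: c_def)
qed

text \<open>The number of lamps is a power of two so that the walks have length
  \<open>2 * N = 2 ^ Suc k\<close>, as the dyadic chain argument requires. In \<open>R\<close>, the
  term \<open>3 * \<delta> + 1\<close> comes from the branch point, \<open>L * A\<close> from one
  step of a walk, and \<open>Suc k * \<delta>\<close> from the logarithm of its length.\<close>

lemma lamp_grid_large_preimage:
  fixes Y :: "'b metric"
  assumes geo: "geodesic_space Y" and hyp: "gromov_hyperbolic \<delta> Y"
    and \<phi>: "\<phi> \<in> mspace X \<rightarrow> mspace Y" and L: "0 \<le> L"
    and lip: "\<And>x y. x \<in> mspace X \<Longrightarrow> y \<in> mspace X \<Longrightarrow> mdist Y (\<phi> x) (\<phi> y) \<le> L * mdist X x y"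
    and grid: "lamp_grid X A (2 ^ k) \<psi>" and A: "0 \<le> A"
  defines "N \<equiv> 2 ^ k" and "p \<equiv> \<psi> ({}, 0)" and "R \<equiv> 3 * \<delta> + 1 + L * A + real (Suc k) * \<delta>"
  shows "p \<in> mspace X \<and> (\<exists>m \<in> mspace Y. \<forall>K.
    finite K \<longrightarrow> mcball_of X p (4 * A * real N) \<inter> \<phi> -` mcball_of Y m R \<subseteq> K \<longrightarrow>
    2 ^ N \<le> (Suc (nat \<lfloor>2 * L * A * real N\<rfloor>))\<^sup>2 * (2 * N) * card K)"
proof -
  note grid = grid[folded N_def]
  define b where "b i = (if i \<le> N then i else 2 * N - i)" for i
  define c where "c S T i = \<psi> (sweep i S T, b i)" for S T i
  define V where "V = Pow {..<N}"
  define q where "q S = \<psi> (S, 0::nat)" for S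
  define n where "n = Suc (nat \<lfloor>2 * L * A * real N\<rfloor>)"
  have cX: "c S T i \<in> mspace X" and cstep: "i < 2 * N \<Longrightarrow> mdist X (c S T i) (c S T (Suc i)) \<le> A"
    and c0: "c S T 0 = q S" and c2: "c S T (2 * N) = q T" if "S \<in> V" "T \<in> V" for S T i
    using lamp_grid_walk[OF grid, of S T] that unfolding c_def b_def q_def V_def by blast+
  have e: "{} \<in> V" by (simp add: V_def)
  have p: "p = q {}" by (simp add: p_def q_def)
  have qX: "q S \<in> mspace X" if "S \<in> V" for S using cX[OF that that, of 0] c0[OF that that] by simp
  have cd: "mdist X (q S) (c S T i) \<le> real i * A" if "S \<in> V" "T \<in> V" "i \<le> 2 * N" for S T i
    using mdist_chain_le[of "c S T" X i A] cX cstep c0 that by auto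
  have qd: "mdist X p (q T) \<le> 2 * real N * A" if "T \<in> V" for T
    using cd[OF e that, of "2 * N"] c2[OF e that] by (simp add: p)
  define w where "w = \<phi> p"
  have w: "w \<in> mspace Y" using \<phi> qX[OF e] by (auto simp: w_def p)
  have qY: "\<phi> (q S) \<in> mspace Y" if "S \<in> V" for S using \<phi> qX[OF that] by auto
  have wq: "mdist Y w (\<phi> (q S)) \<le> 2 * L * A * real N" if "S \<in> V" for S
  proof -
    have "mdist Y w (\<phi> (q S)) \<le> L * mdist X p (q S)"
      using lip[of p "q S"] qX e that by (simp add: w_def p)
    also have "\<dots> \<le> L * (2 * real N * A)" using qd[OF that] L by (intro mult_left_mono)
    finally show ?thesis by (simp add: mult_ac)
  qed
  \<comment> \<open>Rounding leaves at most \<open>n\<close> values for the pigeonhole argument,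
    since a Gromov product at \<open>w\<close> is at most the distance from \<open>w\<close>.
    Products are nonnegative, so \<open>nat\<close> loses nothing.\<close>
  define f where "f S T = nat \<lfloor>gromov_product Y w (\<phi> (q S)) (\<phi> (q T))\<rfloor>" for S T
  have "f S T < n" if "S \<in> V" "T \<in> V" for S T
  proof -
    have "gromov_product Y w (\<phi> (q S)) (\<phi> (q T)) \<le> 2 * L * A * real N"
      using gromov_product_le_mdist[OF w qY qY] wq that by (meson order_trans)
    then show ?thesis
      unfolding f_def n_def by (intro le_imp_less_Suc nat_mono floor_mono)
  qed
  moreover have finV: "finite V" by (simp add: V_def)
  ultimately obtain x j where x: "x \<in> V"
    and le: "(card V)\<^sup>2 \<le> n\<^sup>2 * card {(y, z). y \<in> V \<and> z \<in> V \<and> f y x = j \<and> f y z = j}"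
    using ex_popular_value[of V f n] e by blast
  define H where "H = {(y, z). y \<in> V \<and> z \<in> V \<and> f y x = j \<and> f y z = j}"
  have fj: "real j \<le> gromov_product Y w (\<phi> (q S)) (\<phi> (q T))"
      "gromov_product Y w (\<phi> (q S)) (\<phi> (q T)) < real j + 1"
    if "S \<in> V" "T \<in> V" "f S T = j" for S T
    using gromov_product_nonneg[OF w qY[OF that(1)] qY[OF that(2)]] that(3)
    unfolding f_def by linarith+
  \<comment> \<open>A single pair in \<open>H\<close> shows that \<open>j\<close> is at most the
    distance from \<open>w\<close> to \<open>\<phi> (q x)\<close>, so that a geodesic between them
    has a point at distance \<open>j\<close> from \<open>w\<close>.\<close>
  have Hne: "H \<noteq> {}"
  proof
    assume "H = {}"
    then have "card V = 0" using le[folded H_def] by simp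
    then show False using finV e by auto
  qed
  then obtain y where "y \<in> V" "f y x = j" by (auto simp: H_def)
  then have "real j \<le> mdist Y w (\<phi> (q x))"
    using fj[of y x] gromov_product_le_mdist[OF w qY[OF x] qY[of y]] x
    by (simp add: gromov_product_commute)
  from ex_branch_point[OF geo hyp w qY[OF x] _ this]
  obtain m where m: "m \<in> mspace Y" and near:
    "\<And>y z. y \<in> mspace Y \<Longrightarrow> z \<in> mspace Y \<Longrightarrow> real j \<le> gromov_product Y w y (\<phi> (q x)) \<Longrightarrow>
      real j \<le> gromov_product Y w y z \<Longrightarrow> gromov_product Y w y z < real j + 1 \<Longrightarrow>
      gromov_product Y m y z < 3 * \<delta> + 1" by auto
  have "2 ^ N \<le> n\<^sup>2 * (2 * N) * card K"
    if K: "finite K" and sub: "mcball_of X p (4 * A * real N) \<inter> \<phi> -` mcball_of Y m R \<subseteq> K" for K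
  proof -
    have "\<exists>i < 2 * N. \<psi> (sweep i S T, b i) \<in> K" if "(S, T) \<in> H" for S T
    proof -
      have ST: "S \<in> V" "T \<in> V" "f S x = j" "f S T = j" using that by (auto simp: H_def)
      have N2: "2 * N = 2 ^ Suc k" by (simp add: N_def)
      have "gromov_product Y m (\<phi> (c S T 0)) (\<phi> (c S T (2 ^ Suc k))) < 3 * \<delta> + 1"
        unfolding N2[symmetric] c0[OF ST(1,2)] c2[OF ST(1,2)]
        using near qY fj ST x by auto
      moreover have "mdist Y (\<phi> (c S T i)) (\<phi> (c S T (Suc i))) \<le> L * A" if "i < 2 ^ Suc k" for i
      proof -
        have "mdist Y (\<phi> (c S T i)) (\<phi> (c S T (Suc i))) \<le> L * mdist X (c S T i) (c S T (Suc i))"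
          using lip cX ST by blast
        also have "\<dots> \<le> L * A"
          using cstep[OF ST(1,2)] that L N2 by (intro mult_left_mono) auto
        finally show ?thesis .
      qed
      moreover have cY: "\<phi> (c S T i) \<in> mspace Y" for i using \<phi> cX ST by auto
      ultimately obtain i where i: "i < 2 ^ Suc k" "mdist Y m (\<phi> (c S T i)) \<le> R"
        using chain_meets_ball[OF hyp m, of "\<lambda>i. \<phi> (c S T i)" "Suc k" "L * A" "3 * \<delta> + 1"]
        unfolding R_def by blast
      have "mdist X p (c S T i) \<le> mdist X p (q S) + mdist X (q S) (c S T i)"
        using mdist_triangle qX e cX ST by (metis p)
      also have "\<dots> \<le> 2 * real N * A + real i * A"
        using qd[OF ST(1)] cd[OF ST(1,2), of i] i N2 by auto
      also have "real i * A \<le> real (2 * N) * A"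
        using i(1) A unfolding N2[symmetric] by (intro mult_right_mono) linarith+
      finally have "mdist X p (c S T i) \<le> 4 * A * real N" by (simp add: mult_ac)
      with i m cY cX[OF ST(1,2)] qX[OF e] have
        "c S T i \<in> mcball_of X p (4 * A * real N) \<inter> \<phi> -` mcball_of Y m R" by (simp add: p)
      with sub i N2 show ?thesis unfolding c_def by auto
    qed
    moreover have "inj_on \<psi> (Pow {..<N} \<times> {..N})" using grid by (simp add: lamp_grid_def)
    moreover have "H \<subseteq> Pow {..<N} \<times> Pow {..<N}" by (auto simp: H_def V_def)
    moreover have "b i \<le> N" if "i < 2 * N" for i using that by (auto simp: b_def)
    ultimately have cardH: "card H \<le> 2 * N * card K * 2 ^ N"
      using card_sweeps_through[OF K, of \<psi> N "2 * N" b H] by blast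
    \<comment> \<open>Popularity bounds \<open>card H\<close> from below and the sweeps bound it
      from above; one factor \<open>2 ^ N\<close> cancels.\<close>
    have "2 ^ N * 2 ^ N = (card V)\<^sup>2" by (simp add: V_def card_Pow power2_eq_square)
    also have "\<dots> \<le> n\<^sup>2 * card H" using le by (simp only: H_def)
    also have "\<dots> \<le> n\<^sup>2 * (2 * N * card K * 2 ^ N)" using cardH by (rule mult_le_mono2)
    also have "\<dots> = (n\<^sup>2 * (2 * N) * card K) * 2 ^ N" by (simp only: mult_ac)
    finally show ?thesis by simp
  qed
  with m qX[OF e] show ?thesis unfolding n_def p by blast
qed

section \<open>Failure of polynomial hyperbolicity\<close>

lemma poly_eventually_less_power2:
  fixes Q :: "real poly"
  shows "\<forall>\<^sub>F k in sequentially. poly Q (real k) < 2 ^ k"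
proof -
  have "(\<lambda>k. real k ^ i / 2 ^ k) \<longlonglongrightarrow> 0" for i by real_asymp
  then have "(\<lambda>k. \<Sum>i\<le>degree Q. coeff Q i * (real k ^ i / 2 ^ k)) \<longlonglongrightarrow> (\<Sum>i\<le>degree Q. coeff Q i * 0)"
    by (intro tendsto_intros)
  then have "(\<lambda>k. poly Q (real k) / 2 ^ k) \<longlonglongrightarrow> 0"
    by (simp add: poly_altdef sum_divide_distrib)
  then have "\<forall>\<^sub>F k in sequentially. poly Q (real k) / 2 ^ k < 1"
    by (rule order_tendstoD) simp
  then show ?thesis by (rule eventually_mono) (simp add: field_simps)
qed

lemma ex_le_two_power: "\<exists>n::nat. (x::real) \<le> 2 ^ n"
  using real_arch_pow[of 2 x] by (auto intro: less_imp_le)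

text \<open>For \<open>N = 2 ^ k\<close> the radius \<open>R\<close> is affine in \<open>k\<close>,
  so gentleness bounds the preimage by 2 to a polynomial in \<open>k\<close>, while the count
  demands \<open>2 ^ (2 ^ k)\<close> up to factors \<open>2 ^ O(k)\<close>. It is essential that one
  \<open>A\<close> serves all \<open>N\<close>.\<close>

lemma not_pol_polynomially_hyperbolic_if_lamp_grids:
  fixes X :: "'a metric"
  assumes A: "1 \<le> A" and grids: "\<And>N. \<exists>\<psi>. lamp_grid X A N \<psi>"
  shows "\<not> pol_polynomially_hyperbolic TYPE('b) X"
proof
  assume "pol_polynomially_hyperbolic TYPE('b) X"
  then obtain P :: "real poly" and Y :: "'b metric" and \<phi> where P: "\<And>t. t \<ge> 0 \<Longrightarrow> poly P t \<ge> 0"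
    and Y: "hyperbolic_space Y" and lip: "Lipschitz_continuous_map X Y \<phi>"
    and gentle: "gentle (\<lambda>x y. x powr poly P y) X Y \<phi>"
    unfolding pol_polynomially_hyperbolic_def polynomially_hyperbolic_def by blast
  obtain \<delta> where geo: "geodesic_space Y" and \<delta>: "\<delta> \<ge> 0" and hyp: "gromov_hyperbolic \<delta> Y"
    using Y by (auto simp: hyperbolic_space_def)
  obtain L where \<phi>: "\<phi> \<in> mspace X \<rightarrow> mspace Y" and L: "L > 0" and
    lipL: "\<And>x y. x \<in> mspace X \<Longrightarrow> y \<in> mspace X \<Longrightarrow> mdist Y (\<phi> x) (\<phi> y) \<le> L * mdist X x y"
    using lip unfolding Lipschitz_continuous_map_pos by blast
  obtain C where C: "C \<ge> 0" and bound: "\<And>R\<^sub>1 R\<^sub>2 p q. R\<^sub>1 \<ge> 1 \<Longrightarrow> R\<^sub>2 \<ge> 1 \<Longrightarrow> p \<in> mspace X \<Longrightarrow> q \<in> mspace Y \<Longrightarrow>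
        finite (mcball_of X p R\<^sub>1 \<inter> \<phi> -` mcball_of Y q R\<^sub>2) \<and>
        real (card (mcball_of X p R\<^sub>1 \<inter> \<phi> -` mcball_of Y q R\<^sub>2)) \<le> C * (C * R\<^sub>1) powr poly P (C * R\<^sub>2)"
    using gentle unfolding gentle_def by blast
  \<comment> \<open>All constants are rounded up to powers of two, so that only exponents remain to
    be compared.\<close>
  obtain c1 c2 c3 where c1: "C \<le> 2 ^ c1" and c2: "C * (4 * A) \<le> 2 ^ c2"
    and c3: "2 * L * A + 1 \<le> 2 ^ c3"
    using ex_le_two_power by metis
  define a where "a = 3 * \<delta> + 1 + L * A + \<delta>"
  \<comment> \<open>The sum of the exponents: \<open>2 * (c3 + k)\<close> from the squared number of
    values, \<open>1 + k\<close> from \<open>2 * N\<close>, \<open>c1\<close> from the prefactor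
    \<open>C\<close>, and the product from the gentleness bound, as
    \<open>R = a + k * \<delta>\<close>.\<close>
  define Q where "Q = [:real (2 * c3 + 1 + c1), 3:] + [:real c2, 1:] * (P \<circ>\<^sub>p [:C * a, C * \<delta>:])"
  obtain k where k: "poly Q (real k) < 2 ^ k"
    using poly_eventually_less_power2[of Q] unfolding eventually_sequentially by blast
  define N :: nat where "N = 2 ^ k"
  define R where "R = 3 * \<delta> + 1 + L * A + real (Suc k) * \<delta>"
  obtain \<psi> where "lamp_grid X A (2 ^ k) \<psi>" using grids by blast
  from lamp_grid_large_preimage[OF geo hyp \<phi> less_imp_le[OF L] lipL this] A
  obtain p m where p: "p \<in> mspace X" and m: "m \<in> mspace Y" and
    count: "\<And>K. finite K \<Longrightarrow> mcball_of X p (4 * A * real N) \<inter> \<phi> -` mcball_of Y m R \<subseteq> K \<Longrightarrow>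
      2 ^ N \<le> (Suc (nat \<lfloor>2 * L * A * real N\<rfloor>))\<^sup>2 * (2 * N) * card K"
    unfolding N_def R_def by auto
  define K where "K = mcball_of X p (4 * A * real N) \<inter> \<phi> -` mcball_of Y m R"
  have N1: "real N \<ge> 1" by (simp add: N_def)
  \<comment> \<open>Gentleness is available only for radii at least 1.\<close>
  have "1 * 1 \<le> 4 * A * real N" using A N1 by (intro mult_mono) auto
  moreover have "R \<ge> 1" using \<delta> L A by (simp add: R_def)
  ultimately have K: "finite K" "real (card K) \<le> C * (C * (4 * A * real N)) powr poly P (C * R)"
    using bound[OF _ _ p m] by (simp_all add: K_def)
  have CR: "C * R = poly [:C * a, C * \<delta>:] (real k)" by (simp add: R_def a_def algebra_simps)
  have CR0: "poly P (C * R) \<ge> 0" using P[of "C * R"] C \<open>R \<ge> 1\<close> by simp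
  have "C * (4 * A * real N) \<le> 2 powr (real c2 + real k)"
    using mult_right_mono[OF c2, of "real N"]
    by (simp add: N_def powr_add powr_realpow mult_ac)
  then have "(C * (4 * A * real N)) powr poly P (C * R) \<le> (2 powr (real c2 + real k)) powr poly P (C * R)"
    using CR0 C A by (intro powr_mono2) auto
  then have cardK: "real (card K) \<le> 2 powr real c1 * 2 powr ((real c2 + real k) * poly P (C * R))"
    using K(2) c1 C by (simp add: powr_powr powr_realpow) (smt (verit) mult_mono powr_ge_zero zero_le_power)
  have "real (Suc (nat \<lfloor>2 * L * A * real N\<rfloor>)) \<le> 2 * L * A * real N + 1"
    using L A by simp
  also have "\<dots> \<le> (2 * L * A + 1) * real N" using N1 by (simp add: algebra_simps)
  also have "\<dots> \<le> 2 powr (real c3 + real k)"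
    using mult_right_mono[OF c3, of "real N"] by (simp add: N_def powr_add powr_realpow)
  finally have "(real (Suc (nat \<lfloor>2 * L * A * real N\<rfloor>)))\<^sup>2 \<le> (2 powr (real c3 + real k))\<^sup>2"
    by (intro power_mono) auto
  also have "\<dots> = 2 powr (2 * (real c3 + real k))" by (simp add: power2_eq_square flip: powr_add)
  finally have n2: "(real (Suc (nat \<lfloor>2 * L * A * real N\<rfloor>)))\<^sup>2 \<le> 2 powr (2 * (real c3 + real k))" .
  have "real (2 ^ N) \<le> real ((Suc (nat \<lfloor>2 * L * A * real N\<rfloor>))\<^sup>2 * (2 * N) * card K)"
    using count[OF K(1)] unfolding K_def by (simp only: of_nat_le_iff order_refl)
  also have "\<dots> = (real (Suc (nat \<lfloor>2 * L * A * real N\<rfloor>)))\<^sup>2 * (2 * real N) * real (card K)"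
    by (simp only: of_nat_mult of_nat_power of_nat_numeral)
  also have "\<dots> \<le> 2 powr (2 * (real c3 + real k)) * 2 powr (1 + real k) *
      (2 powr real c1 * 2 powr ((real c2 + real k) * poly P (C * R)))"
    using n2 cardK by (intro mult_mono) (auto simp: N_def powr_add powr_realpow)
  also have "\<dots> = 2 powr poly Q (real k)"
    unfolding powr_add[symmetric] Q_def CR by (simp add: poly_pcompose algebra_simps)
  also have "\<dots> < 2 powr real N" using k by (simp add: N_def)
  also have "\<dots> = real (2 ^ N)" by (simp add: powr_realpow)
  finally show False by simp
qed

section \<open>Lamplighter graphs in the two examples\<close>

lemma (in connected_locally_finite_graph) mspace_graph_metric: "mspace (graph_metric V E) = V"
  unfolding graph_metric_def using Metric_space_path_dist by (rule Metric_space.mspace_metric)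

lemma (in connected_locally_finite_graph) mdist_graph_metric_le:
  assumes "(x, y) \<in> E ^^ n"
  shows "mdist (graph_metric V E) x y \<le> real n"
  unfolding graph_metric_def Metric_space.mdist_metric[OF Metric_space_path_dist]
  using assms by (simp add: path_dist_def Least_le)

text \<open>The constant 2 pays for toggling the lamp at \<open>p\<close>, if necessary, and for the
  move to \<open>Suc p\<close>.\<close>

lemma lamp_grid_Lamp_Z: "lamp_grid Lamp_Z 2 N (\<lambda>(S, p). (int ` S, int p))"
  unfolding lamp_grid_def
proof (intro conjI ballI allI impI)
  interpret connected_locally_finite_graph lamp_verts lamp_edges by (rule lamp_graph)
  show "(\<lambda>(S, p). (int ` S, int p)) \<in> Pow {..<N} \<times> {..N} \<rightarrow> mspace Lamp_Z"
    unfolding Lamp_Z_def mspace_graph_metric by (auto simp: lamp_verts_def intro: finite_subset)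
  show "inj_on (\<lambda>(S, p). (int ` S, int p)) (Pow {..<N} \<times> {..N})"
    by (auto simp: inj_on_def inj_image_eq_iff)
  fix S T p
  assume ST: "S \<in> Pow {..<N}" "T \<in> Pow {..<N}" "S - {p} = T - {p}"
  then have fin: "finite S" "finite T" by (auto intro: finite_subset)
  have move: "((int ` T, int p), (int ` T, int (Suc p))) \<in> lamp_edges"
    using fin by (simp add: lamp_edges_def)
  have "\<exists>n\<le>2. ((int ` S, int p), (int ` T, int (Suc p))) \<in> lamp_edges ^^ n"
  proof (cases "S = T")
    case True
    with move have "((int ` S, int p), (int ` T, int (Suc p))) \<in> lamp_edges ^^ 1" by simp
    then show ?thesis by (meson one_le_numeral)
  next
    case False
    with ST have "T = sym_diff S {p}" by blast
    then have "int ` T = sym_diff (int ` S) {int p}" by auto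
    then have "((int ` S, int p), (int ` T, int p)) \<in> lamp_edges"
      using fin by (simp add: lamp_edges_def)
    with move have "((int ` S, int p), (int ` T, int (Suc p))) \<in> lamp_edges ^^ 2"
      by (auto simp: numeral_2_eq_2)
    then show ?thesis by blast
  qed
  then obtain n where "n \<le> 2" "((int ` S, int p), (int ` T, int (Suc p))) \<in> lamp_edges ^^ n" by blast
  then have "mdist Lamp_Z (int ` S, int p) (int ` T, int (Suc p)) \<le> 2"
    using mdist_graph_metric_le[of "(int ` S, int p)" "(int ` T, int (Suc p))" n]
    by (simp add: Lamp_Z_def)
  then show "mdist Lamp_Z (case (S, p) of (S, p) \<Rightarrow> (int ` S, int p))
      (case (T, Suc p) of (S, p) \<Rightarrow> (int ` S, int p)) \<le> 2" by simp
qed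

text \<open>Left translations preserve the edges, so a path from the identity to \<open>h\<close> is
  carried to one of the same length from \<open>g\<close> to \<open>g \<otimes> h\<close>. The bound
  is therefore uniform in \<open>g\<close>.\<close>

lemma (in group) ex_mdist_Cayley_mult_le:
  assumes S: "finite_generating_set G S" and h: "h \<in> carrier G"
  shows "\<exists>n::nat. \<forall>g \<in> carrier G. mdist (Cayley G S) g (g \<otimes> h) \<le> real n"
proof -
  interpret cayley: connected_locally_finite_graph "carrier G" "cayley_edges G S"
    by (rule cayley_graph[OF S])
  have SG: "S \<subseteq> carrier G" using S by (simp add: finite_generating_set_def)
  obtain n where n: "(\<one>, h) \<in> cayley_edges G S ^^ n"
    using cayley.connected[of \<one> h] h by (auto simp: rtrancl_power)
  have edge: "(g \<otimes> x, g \<otimes> y) \<in> cayley_edges G S"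
    if "(x, y) \<in> cayley_edges G S" "g \<in> carrier G" for g x y
    using that SG by (auto simp: cayley_edges_def m_assoc subset_iff)
  have "(g \<otimes> \<one>, g \<otimes> h) \<in> cayley_edges G S ^^ n" if "g \<in> carrier G" for g
    using n
  proof (induction n arbitrary: h)
    case (Suc n)
    then obtain y where y: "(\<one>, y) \<in> cayley_edges G S ^^ n" "(y, h) \<in> cayley_edges G S" by auto
    from Suc.IH[OF y(1)] edge[OF y(2) that] show ?case by auto
  qed simp
  then have "mdist (Cayley G S) g (g \<otimes> h) \<le> real n" if "g \<in> carrier G" for g
    using that cayley.mdist_graph_metric_le[of g "g \<otimes> h" n] by (simp add: Cayley_def)
  then show ?thesis by blast
qed

text \<open>Words without inverse letters admit no cancellation.\<close>

lemma reduced_positive: "reduced (map (\<lambda>i. (f i, True)) xs)"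
  unfolding reduced_def successively_map
  by (rule successively_mono[where P = "\<lambda>_ _. True"]) (auto simp: inv_letter_def successively_conv_nth)

text \<open>
  The letters record the lamps: those before \<open>p\<close> form the first word and the remaining ones, in
  reverse, the second word, so that moving the lamplighter multiplies both words on the right.
\<close>

definition lamp_words :: "nat \<Rightarrow> nat set \<times> nat \<Rightarrow> (bool \<times> bool) list \<times> (bool \<times> bool) list" where
  "lamp_words N = (\<lambda>(S, p). (map (\<lambda>i. (i \<in> S, True)) [0..<p], map (\<lambda>i. (i \<in> S, True)) (rev [p..<N])))"

lemma inj_on_lamp_words: "inj_on (lamp_words N) (Pow {..<N} \<times> {..N})"
proof (rule inj_onI, clarify)
  fix S p T q
  assume "S \<subseteq> {..<N}" "T \<subseteq> {..<N}" and eq: "lamp_words N (S, p) = lamp_words N (T, q)"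
  \<comment> \<open>The length of the first word reveals the position of the lamplighter.\<close>
  have "length (fst (lamp_words N (S, p))) = length (fst (lamp_words N (T, q)))" by (simp only: eq)
  then have pq: "p = q" by (simp add: lamp_words_def)
  have "i \<in> S \<longleftrightarrow> i \<in> T" if "i < N" for i
    using eq that unfolding pq lamp_words_def
    by (cases "i < q") auto
  with \<open>S \<subseteq> _\<close> \<open>T \<subseteq> _\<close> pq show "S = T \<and> p = q" by auto
qed

text \<open>The first word gains a letter for the new state of the lamp at \<open>p\<close>; the
  second loses its last letter, which records the old state, by cancellation. Only four multipliers
  occur, whatever \<open>N\<close> is.\<close>

lemma lamp_words_step:
  assumes p: "p < N" and ST: "S - {p} = T - {p}"
  shows "lamp_words N (T, Suc p) =
    lamp_words N (S, p) \<otimes>\<^bsub>F2 \<times>\<times> F2\<^esub> ([(p \<in> T, True)], [(p \<in> S, False)])"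
proof -
  have same: "i \<in> S \<longleftrightarrow> i \<in> T" if "i \<noteq> p" for i using ST that by blast
  let ?u = "\<lambda>S. map (\<lambda>i. (i \<in> S, True)) [0..<p]" and ?v = "\<lambda>S. map (\<lambda>i. (i \<in> S, True)) (rev [Suc p..<N])"
  have uv: "?u T = ?u S" "?v T = ?v S" using same by auto
  have "foldr cons_reduce (?u S) [(p \<in> T, True)] = foldr cons_reduce (?u S @ [(p \<in> T, True)]) []"
    by simp
  also have "?u S @ [(p \<in> T, True)] = map (\<lambda>i. (i \<in> T, True)) [0..<Suc p]" using uv by simp
  also have "foldr cons_reduce \<dots> [] = \<dots>" by (intro foldr_cons_reduce_Nil reduced_positive)
  finally have 1: "foldr cons_reduce (?u S) [(p \<in> T, True)] = map (\<lambda>i. (i \<in> T, True)) [0..<Suc p]" .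
  have "map (\<lambda>i. (i \<in> S, True)) (rev [p..<N]) = ?v S @ [(p \<in> S, True)]"
    using p by (simp add: upt_conv_Cons)
  then have 2: "foldr cons_reduce (map (\<lambda>i. (i \<in> S, True)) (rev [p..<N])) [(p \<in> S, False)] = ?v T"
    using foldr_cons_reduce_Nil[OF reduced_positive, of "\<lambda>i. i \<in> S" "rev [Suc p..<N]"] uv
    by (simp add: inv_letter_def)
  from 1 2 show ?thesis by (simp add: lamp_words_def DirProd_def free_group_def)
qed

lemma ex_lamp_grid_F2_times_F2:
  assumes S: "finite_generating_set (F2 \<times>\<times> F2) S"
  shows "\<exists>A\<ge>1. \<forall>N. lamp_grid (Cayley (F2 \<times>\<times> F2) S) A N (lamp_words N)"
proof -
  interpret group "F2 \<times>\<times> F2" by (intro DirProd_group group_free_group)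
  interpret cayley: connected_locally_finite_graph "carrier (F2 \<times>\<times> F2)" "cayley_edges (F2 \<times>\<times> F2) S"
    by (rule cayley_graph[OF S])
  have "([(t, True)], [(s, False)]) \<in> carrier (F2 \<times>\<times> F2)" for s t
    by (simp add: DirProd_def free_group_def reduced_def)
  from ex_mdist_Cayley_mult_le[OF S this]
  have "\<forall>s. \<exists>m. \<forall>t. \<forall>g \<in> carrier (F2 \<times>\<times> F2).
      mdist (Cayley (F2 \<times>\<times> F2) S) g (g \<otimes>\<^bsub>F2 \<times>\<times> F2\<^esub> ([(t, True)], [(s, False)])) \<le> real (m t)"
    by (intro allI choice)
  then obtain n :: "bool \<Rightarrow> bool \<Rightarrow> nat" where
    n: "\<forall>s t. \<forall>g \<in> carrier (F2 \<times>\<times> F2).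
      mdist (Cayley (F2 \<times>\<times> F2) S) g (g \<otimes>\<^bsub>F2 \<times>\<times> F2\<^esub> ([(t, True)], [(s, False)])) \<le> real (n s t)"
    by (rule choice[THEN exE])
  \<comment> \<open>The sum dominates the bounds for all four multipliers, and \<open>Suc\<close>
    ensures \<open>A \<ge> 1\<close>.\<close>
  define A where "A = real (Suc (\<Sum>s\<in>UNIV. \<Sum>t\<in>UNIV. n s t))"
  have nA: "real (n s t) \<le> A" for s t
    unfolding A_def by (cases s; cases t) (simp_all add: UNIV_bool)
  have car: "lamp_words N (S, p) \<in> carrier (F2 \<times>\<times> F2)" for N S p
    by (simp add: lamp_words_def DirProd_def free_group_def reduced_positive)
  have "lamp_grid (Cayley (F2 \<times>\<times> F2) S) A N (lamp_words N)" for N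
    unfolding lamp_grid_def
  proof (intro conjI ballI allI impI)
    show "lamp_words N \<in> Pow {..<N} \<times> {..N} \<rightarrow> mspace (Cayley (F2 \<times>\<times> F2) S)"
      using car unfolding Cayley_def cayley.mspace_graph_metric by auto
    show "inj_on (lamp_words N) (Pow {..<N} \<times> {..N})" by (rule inj_on_lamp_words)
    show "mdist (Cayley (F2 \<times>\<times> F2) S) (lamp_words N (T, p)) (lamp_words N (U, Suc p)) \<le> A"
      if "p < N" "T - {p} = U - {p}" for T U p
      unfolding lamp_words_step[OF that] using n car nA order_trans by blast
  qed
  moreover have "A \<ge> 1" unfolding A_def by linarith
  ultimately show ?thesis by blast
qed

theorem theorem1p3:
  shows "\<not> pol_polynomially_hyperbolic TYPE('b) Lamp_Z \<and>
    (\<forall>S. finite_generating_set (F2 \<times>\<times> F2) S \<longrightarrow>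
       \<not> pol_polynomially_hyperbolic TYPE('b) (Cayley (F2 \<times>\<times> F2) S))"
proof (intro conjI allI impI)
  show "\<not> pol_polynomially_hyperbolic TYPE('b) Lamp_Z"
    using not_pol_polynomially_hyperbolic_if_lamp_grids[of 2] lamp_grid_Lamp_Z by fastforce
  show "\<not> pol_polynomially_hyperbolic TYPE('b) (Cayley (F2 \<times>\<times> F2) S)"
    if "finite_generating_set (F2 \<times>\<times> F2) S" for S
    using ex_lamp_grid_F2_times_F2[OF that] not_pol_polynomially_hyperbolic_if_lamp_grids by blast
qed

end
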